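(* Let $1<p,q<\infty$ with $1/p+1/q=1$ and let $n,d\in\mathbb{N}$ be positive integers. For each $k=1,\dots,n$, let $f_k\in L^p(\mathbb{R}^d)$ be a nonzero function and let $\Gamma_k$ be an arbitrary sequence in $\mathbb{R}^d$. Let $\Gamma$ be the disjoint union of $\Gamma_1,\dots,\Gamma_n$, and let $\bigcup_{k=1}^n T_p(f_k,\Gamma_k)$ be the disjoint union of the families $T_p(f_k,\Gamma_k)=\{T_\gamma f_k\}_{\gamma\in\Gamma_k}$. Then: (i) If for some $1<p'<\infty$ the family $\bigcup_{k=1}^n T_p(f_k,\Gamma_k)$ is a $p'$-Bessel sequence, then $D^+(\Gamma)<\infty$. (ii) If $\bigcup_{k=1}^n T_p(f_k,\Gamma_k)$ is a $(C_q)$-system in $L^p(\mathbb{R}^d)$, then $D^+(\Gamma)=\infty$. In particular, for no $1<p'<\infty$ is there a family of the form $\bigcup_{k=1}^n T_p(f_k,\Gamma_k)$ in $L^p(\mathbb{R}^d)$ that is both a $p'$-Bessel sequence and a $(C_q)$-system.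
   Context: Translation: for $\gamma\in\mathbb{R}^d$, $(T_\gamma f)(x)=f(x-\gamma)$. Sequences: a sequence $\Gamma=\{\gamma_i\}_{i\in I}$ in $\mathbb{R}^d$ is a family indexed by a countable set $I$; repetitions are allowed, and all cardinalities $\#$, sums over $\gamma\in\Gamma$ and (disjoint) unions are taken with respect to indices, i.e. with multiplicity. $T_p(f,\Gamma)=\{T_{\gamma_i}f\}_{i\in I}$. Upper Beurling density: for $h>0$ and $x=(x_1,\dots,x_d)\in\mathbb{R}^d$ let $Q_h(x)=\prod_{i=1}^d[x_i-h/2,x_i+h/2)$. Put $\nu_\Gamma^+(h)=\sup_{x\in\mathbb{R}^d}\#(\Gamma\cap Q_h(x))$ (the supremum of the number of indices $i$ with $\gamma_i\in Q_h(x)$) and $D^+(\Gamma)=\limsup_{h\to\infty}\nu_\Gamma^+(h)/h^d\in[0,\infty]$. $r$-Bessel sequence ($1<r<\infty$): a countable family $\{g_j\}$ in a separable Banach space $X$ is an $r$-Bessel sequence if there is a constant $B>0$ with $\sum_j|\langle h,g_j\rangle|^r\le B\|h\|^r$ for all $h\in X^*$. Here $X=L^p(\mathbb{R}^d)$, $X^*=L^q(\mathbb{R}^d)$. $(C_r)$-system ($1<r<\infty$): a countable family $\{g_j\}$ in a separable reflexive Banach space $X$ is a $(C_r)$-system in $X$ if there is a constant $C>0$ such that for every $f\in X$ and every $\varepsilon>0$ there is a finite linear combination $g=\sum a_jg_j$ with $\|f-g\|_X<\varepsilon$ and $(\sum|a_j|^r)^{1/r}\le C\|f\|_X$. *)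

theory Defs
  imports "HOL-Analysis.Analysis"
begin

text \<open>
  Elements of \<open>L\<^sup>p(\<real>\<^sup>d)\<close> are represented by complex-valued functions rather than by
  almost-everywhere classes, so \<open>Lp_norm p\<close> is a seminorm on \<open>Lp p\<close>, and the zero element
  is represented by the functions that vanish almost everywhere.
\<close>

definition Lp :: "real \<Rightarrow> (real ^ 'd \<Rightarrow> complex) set" where
  "Lp p = {f \<in> borel_measurable lebesgue. integrable lebesgue (\<lambda>x. norm (f x) powr p)}"

definition Lp_norm :: "real \<Rightarrow> (real ^ 'd \<Rightarrow> complex) \<Rightarrow> real" where
  "Lp_norm p f = (LINT x|lebesgue. norm (f x) powr p) powr (1 / p)"

definition translate :: "real ^ 'd \<Rightarrow> (real ^ 'd \<Rightarrow> complex) \<Rightarrow> real ^ 'd \<Rightarrow> complex" where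
  "translate \<gamma> f = (\<lambda>x. f (x - \<gamma>))"

text \<open>
  A sequence in \<open>\<real>\<^sup>d\<close> is a pair of an index set \<open>I\<close> and a map \<open>\<gamma>\<close> on it, so that repetitions
  are allowed. Points are counted with multiplicity, with value \<open>\<infinity>\<close> for infinitely many
  indices.
\<close>

definition cube :: "real \<Rightarrow> real ^ 'd \<Rightarrow> (real ^ 'd) set" where
  "cube h x = {y. \<forall>i. x $ i - h / 2 \<le> y $ i \<and> y $ i < x $ i + h / 2}"

definition upper_count :: "'i set \<Rightarrow> ('i \<Rightarrow> real ^ 'd) \<Rightarrow> real \<Rightarrow> ennreal" where
  "upper_count I \<gamma> h = (SUP x. emeasure (count_space I) {i \<in> I. \<gamma> i \<in> cube h x})"

definition upper_Beurling_density :: "'i set \<Rightarrow> ('i \<Rightarrow> real ^ 'd) \<Rightarrow> ennreal" where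
  "upper_Beurling_density I \<gamma> =
     Limsup at_top (\<lambda>h::real. upper_count I \<gamma> h / ennreal (h ^ CARD('d)))"

text \<open>
  The dual of \<open>L\<^sup>p\<close> is \<open>L\<^sup>q\<close> for the conjugate exponent \<open>q\<close>, with \<open>h\<close> acting as the linear
  functional below. Since \<open>L\<^sup>q\<close> is closed under conjugation, the sesquilinear pairing yields
  the same Bessel sequences.
\<close>

definition dual_pairing :: "(real ^ 'd \<Rightarrow> complex) \<Rightarrow> (real ^ 'd \<Rightarrow> complex) \<Rightarrow> complex" where
  "dual_pairing h g = (LINT x|lebesgue. h x * g x)"

text \<open>
  \<open>Bessel_sequence p q r J g\<close>: the family \<open>g\<close> over \<open>J\<close> is an \<open>r\<close>-Bessel sequence in \<open>L\<^sup>p\<close>; here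
  \<open>q\<close> is meant to be the exponent conjugate to \<open>p\<close>. The sum is taken in the extended
  nonnegative reals, so the bound entails convergence.
\<close>

definition Bessel_sequence ::
    "real \<Rightarrow> real \<Rightarrow> real \<Rightarrow> 'j set \<Rightarrow> ('j \<Rightarrow> real ^ 'd \<Rightarrow> complex) \<Rightarrow> bool" where
  "Bessel_sequence p q r J g \<longleftrightarrow>
     countable J \<and> g ` J \<subseteq> Lp p \<and>
     (\<exists>B>0. \<forall>h\<in>Lp q.
        (\<Sum>\<^sub>\<infinity>j\<in>J. ennreal (norm (dual_pairing h (g j)) powr r))
          \<le> ennreal (B * Lp_norm q h powr r))"

definition C_system ::
    "real \<Rightarrow> real \<Rightarrow> 'j set \<Rightarrow> ('j \<Rightarrow> real ^ 'd \<Rightarrow> complex) \<Rightarrow> bool" where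
  "C_system p r J g \<longleftrightarrow>
     countable J \<and> g ` J \<subseteq> Lp p \<and>
     (\<exists>C>0. \<forall>f\<in>Lp p. \<forall>\<epsilon>>0. \<exists>F a. finite F \<and> F \<subseteq> J \<and>
        Lp_norm p (\<lambda>x. f x - (\<Sum>j\<in>F. a j * g j x)) < \<epsilon> \<and>
        (\<Sum>j\<in>F. norm (a j) powr r) powr (1 / r) \<le> C * Lp_norm p f)"

end

theory Submission
  imports Defs
begin

text \<open>
  Both halves rest on the same observation: \<open>D\<^sup>+(\<Gamma>)\<close> is finite exactly when the number of points of
  \<open>\<Gamma>\<close> in a unit cube is bounded (\<open>upper_Beurling_density_finite_iff\<close>), because a cube of side
  \<open>h \<ge> 1\<close> is covered by at most \<open>(2h)\<^sup>d\<close> unit cubes. By the same covering argument, cubes of any other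
  fixed side serve as well as unit cubes.

  Bessel sequences. A nonzero \<open>f\<close> in \<open>L\<^sup>p\<close> has a nonzero integral over some box, by Lebesgue
  differentiation. This integral depends continuously on a translation of the box, so it stays
  away from \<open>0\<close> for all small shifts. Hence the indicator function of the box translated by \<open>x\<close>,
  whose \<open>L\<^sup>q\<close> norm does not depend on \<open>x\<close>, pairs with \<open>T\<^sub>\<gamma> f\<close> to a value of modulus at least \<open>c > 0\<close>
  whenever \<open>\<gamma>\<close> lies in a small cube about \<open>x\<close> (\<open>exists_uniform_test_functions\<close>). The Bessel
  inequality for this test function bounds the number of such \<open>\<gamma>\<close> uniformly in \<open>x\<close>. Doing this
  for each generator and adding the finitely many bounds shows that the density is finite.

  \<open>(C\<^sub>q)\<close>-systems. Approximating the indicator function of \<open>Q\<close> by a combination of the \<open>g\<^sub>j\<close> with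
  controlled coefficients, and applying Hoelder's inequality for sums at each point, shows that the
  total mass \<open>\<Sum>\<^sub>j \<integral>\<^sub>Q |g\<^sub>j|\<^sup>p\<close> is bounded below by a constant that does not depend on \<open>Q\<close>, however
  small the positive measure of \<open>Q\<close> is (\<open>C_system_local_mass_bound\<close>). If the density were finite, the mass would however
  tend to \<open>0\<close> as \<open>Q\<close> shrinks to the origin
  (\<open>translates_mass_in_shrinking_cubes_tendsto_0\<close>): for translates of one function \<open>f\<close> it equals
  the integral of \<open>|f(y)|\<^sup>p\<close> against the number of points of \<open>\<Gamma>\<close> in the cube about \<open>-y\<close>, and this
  number is bounded and is eventually \<open>0\<close> for almost every \<open>y\<close>.
\<close>

section \<open>Counting points in cubes\<close>

lemma mem_cube_iff: "y \<in> cube h x \<longleftrightarrow> (\<forall>i. - (h / 2) \<le> y $ i - x $ i \<and> y $ i - x $ i < h / 2)"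
  unfolding cube_def mem_Collect_eq by (intro all_cong1) argo

lemma mem_cube_diff: "y \<in> cube h x \<longleftrightarrow> y - x \<in> cube h 0"
  by (simp add: mem_cube_iff)

lemma cube_mono:
  assumes "h \<le> h'"
  shows "cube h x \<subseteq> cube h' x"
proof
  fix y assume "y \<in> cube h x"
  then have "- (h / 2) \<le> y $ i - x $ i \<and> y $ i - x $ i < h / 2" for i
    by (simp add: mem_cube_iff)
  then have "- (h' / 2) \<le> y $ i - x $ i \<and> y $ i - x $ i < h' / 2" for i
    using assms by (smt (verit) divide_right_mono)
  then show "y \<in> cube h' x" by (simp add: mem_cube_iff)
qed

lemma upper_count_mono:
  assumes "h \<le> h'"
  shows "upper_count I \<gamma> h \<le> upper_count I \<gamma> h'"
  unfolding upper_count_def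
proof (rule SUP_mono')
  show "emeasure (count_space I) {i \<in> I. \<gamma> i \<in> cube h x}
      \<le> emeasure (count_space I) {i \<in> I. \<gamma> i \<in> cube h' x}" for x
    using cube_mono[OF assms, of x] by (intro emeasure_mono) auto
qed

lemma upper_count_subadditive:
  assumes "finite K"
  shows "upper_count (\<Union>k\<in>K. I k) \<gamma> h \<le> (\<Sum>k\<in>K. upper_count (I k) \<gamma> h)"
  unfolding upper_count_def[of "\<Union>k\<in>K. I k"]
proof (rule SUP_least)
  fix x
  let ?U = "\<Union>k\<in>K. I k"
  have "emeasure (count_space ?U) {i \<in> ?U. \<gamma> i \<in> cube h x} =
      emeasure (count_space ?U) (\<Union>k\<in>K. {i \<in> I k. \<gamma> i \<in> cube h x})"
    by (rule arg_cong[where f = "emeasure _"]) auto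
  also have "\<dots> \<le> (\<Sum>k\<in>K. emeasure (count_space ?U) {i \<in> I k. \<gamma> i \<in> cube h x})"
    using assms by (intro emeasure_subadditive_finite) auto
  also have "\<dots> = (\<Sum>k\<in>K. emeasure (count_space (I k)) {i \<in> I k. \<gamma> i \<in> cube h x})"
  proof (intro sum.cong refl)
    fix k assume "k \<in> K"
    then have "{i \<in> I k. \<gamma> i \<in> cube h x} \<subseteq> ?U" by blast
    then show "emeasure (count_space ?U) {i \<in> I k. \<gamma> i \<in> cube h x} =
        emeasure (count_space (I k)) {i \<in> I k. \<gamma> i \<in> cube h x}"
      by (metis (no_types, lifting) emeasure_count_space mem_Collect_eq subsetI)
  qed
  also have "\<dots> \<le> (\<Sum>k\<in>K. upper_count (I k) \<gamma> h)"
    unfolding upper_count_def by (intro sum_mono SUP_upper) auto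
  finally show "emeasure (count_space ?U) {i \<in> ?U. \<gamma> i \<in> cube h x} \<le> \<dots>" .
qed

text \<open>
  A cube of side at most \<open>N \<delta>\<close> is covered by \<open>N\<^sup>d\<close> cubes of side \<open>\<delta>\<close>, arranged as a grid that
  starts at its lower corner.
\<close>

lemma upper_count_le_subcubes:
  fixes \<gamma> :: "'i \<Rightarrow> real ^ 'd"
  assumes "\<delta> > 0" "h \<le> real N * \<delta>"
  shows "upper_count I \<gamma> h \<le> of_nat (N ^ CARD('d)) * upper_count I \<gamma> \<delta>"
  unfolding upper_count_def[of I \<gamma> h]
proof (rule SUP_least)
  fix x :: "real ^ 'd"
  define M :: "('d \<Rightarrow> nat) set" where "M = PiE UNIV (\<lambda>_. {..<N})"
  define c :: "('d \<Rightarrow> nat) \<Rightarrow> real ^ 'd"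
    where "c m = (\<chi> j. x $ j - h / 2 + (real (m j) + 1 / 2) * \<delta>)" for m
  have M: "finite M" "card M = N ^ CARD('d)"
    by (auto simp: M_def card_PiE intro: finite_PiE)
  have cover: "\<exists>m\<in>M. y \<in> cube \<delta> (c m)" if y: "y \<in> cube h x" for y
  proof
    \<comment> \<open>The coordinates of \<open>y\<close> relative to the lower corner, in units of \<open>\<delta>\<close>;
      their integer parts select the grid cube that contains \<open>y\<close>.\<close>
    define t where "t j = (y $ j - x $ j + h / 2) / \<delta>" for j
    define m where "m j = nat \<lfloor>t j\<rfloor>" for j
    have t: "0 \<le> t j" "t j < real N" for j
    proof -
      have b: "x $ j - h / 2 \<le> y $ j" "y $ j < x $ j + h / 2"
        using y by (auto simp: cube_def)
      show "0 \<le> t j" using b assms by (simp add: t_def)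
      have "y $ j - x $ j + h / 2 < real N * \<delta>" using b assms by linarith
      then show "t j < real N" using assms by (simp add: t_def field_simps)
    qed
    have m: "real (m j) \<le> t j" "t j < real (m j) + 1" for j
      using t(1)[of j] by (auto simp: m_def)
    have "m j < N" for j
      using t(2)[of j] m(1)[of j] by linarith
    then show "m \<in> M" by (auto simp: M_def)
    have "real (m j) * \<delta> \<le> y $ j - x $ j + h / 2"
         "y $ j - x $ j + h / 2 < (real (m j) + 1) * \<delta>" for j
      using m[of j] assms(1) by (auto simp: t_def field_simps)
    then show "y \<in> cube \<delta> (c m)"
      by (auto simp: cube_def c_def algebra_simps)
  qed
  have "emeasure (count_space I) {i \<in> I. \<gamma> i \<in> cube h x}
      \<le> emeasure (count_space I) (\<Union>m\<in>M. {i \<in> I. \<gamma> i \<in> cube \<delta> (c m)})"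
    by (rule emeasure_mono) (use cover in auto)
  also have "\<dots> \<le> (\<Sum>m\<in>M. emeasure (count_space I) {i \<in> I. \<gamma> i \<in> cube \<delta> (c m)})"
    using M(1) by (intro emeasure_subadditive_finite) auto
  also have "\<dots> \<le> of_nat (card M) * upper_count I \<gamma> \<delta>"
    unfolding upper_count_def by (intro sum_bounded_above SUP_upper) auto
  finally show "emeasure (count_space I) {i \<in> I. \<gamma> i \<in> cube h x}
      \<le> of_nat (N ^ CARD('d)) * upper_count I \<gamma> \<delta>"
    by (simp add: M)
qed

lemma upper_count_finite_rescale:
  fixes \<gamma> :: "'i \<Rightarrow> real ^ 'd"
  assumes "\<delta> > 0" "upper_count I \<gamma> \<delta> < \<infinity>"
  shows "upper_count I \<gamma> h < \<infinity>"
proof -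
  obtain N where "h / \<delta> \<le> real N"
    using real_arch_simple by blast
  then have "upper_count I \<gamma> h \<le> of_nat (N ^ CARD('d)) * upper_count I \<gamma> \<delta>"
    using assms by (intro upper_count_le_subcubes) (auto simp: field_simps)
  also have "\<dots> < \<infinity>"
    using assms by (simp add: ennreal_mult_less_top ennreal_of_nat_eq_real_of_nat del: of_nat_power)
  finally show ?thesis .
qed

text \<open>
  If the limes superior is finite, then so is the count for some \<open>h \<ge> 1\<close>, and cubes of side \<open>h\<close>
  contain unit cubes. For the converse, \<open>\<lceil>h\<rceil>\<^sup>d \<le> (2h)\<^sup>d\<close> unit cubes cover a cube of side
  \<open>h \<ge> 1\<close>, which bounds the quotient by \<open>2\<^sup>d\<close> times the count in unit cubes.
\<close>

lemma upper_Beurling_density_finite_iff: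
  fixes \<gamma> :: "'i \<Rightarrow> real ^ 'd"
  shows "upper_Beurling_density I \<gamma> < \<infinity> \<longleftrightarrow> upper_count I \<gamma> 1 < \<infinity>"
proof
  assume "upper_Beurling_density I \<gamma> < \<infinity>"
  then have "eventually (\<lambda>h. upper_count I \<gamma> h / ennreal (h ^ CARD('d)) < \<infinity>) at_top"
    unfolding upper_Beurling_density_def by (rule Limsup_lessD)
  then have "eventually (\<lambda>h. h \<ge> 1 \<and> upper_count I \<gamma> h / ennreal (h ^ CARD('d)) < \<infinity>) at_top"
    using eventually_ge_at_top eventually_conj by blast
  then obtain h :: real where h: "h \<ge> 1" "upper_count I \<gamma> h / ennreal (h ^ CARD('d)) < \<infinity>"
    using eventually_happens by fastforce
  have "upper_count I \<gamma> h < \<infinity>"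
    using h by (metis ennreal_divide_eq_top_iff ennreal_neq_top infinity_ennreal_def less_top)
  then show "upper_count I \<gamma> 1 < \<infinity>"
    using upper_count_mono[OF h(1), of I \<gamma>] by auto
next
  let ?U = "upper_count I \<gamma> 1"
  assume fin: "?U < \<infinity>"
  have "upper_count I \<gamma> h / ennreal (h ^ CARD('d)) \<le> ennreal (2 ^ CARD('d)) * ?U" if "h \<ge> 1" for h
  proof -
    define N where "N = nat \<lceil>h\<rceil>"
    have N: "h \<le> real N" "real N \<le> 2 * h"
      using that unfolding N_def by linarith+
    have "upper_count I \<gamma> h \<le> of_nat (N ^ CARD('d)) * ?U"
      using N by (intro upper_count_le_subcubes) auto
    also have "of_nat (N ^ CARD('d)) = ennreal (real N ^ CARD('d))"
      by (simp add: ennreal_of_nat_eq_real_of_nat)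
    also have "\<dots> \<le> ennreal ((2 * h) ^ CARD('d))"
      using N by (intro ennreal_leI power_mono) auto
    also have "\<dots> = ennreal (2 ^ CARD('d)) * ennreal (h ^ CARD('d))"
      using that by (simp add: power_mult_distrib ennreal_mult)
    finally have "upper_count I \<gamma> h \<le> (ennreal (2 ^ CARD('d)) * ?U) * ennreal (h ^ CARD('d))"
      by (simp add: mult_ac mult_right_mono)
    then show ?thesis
      using that by (intro divide_le_posI_ennreal) (auto simp: mult_ac)
  qed
  then have "upper_Beurling_density I \<gamma> \<le> ennreal (2 ^ CARD('d)) * ?U"
    unfolding upper_Beurling_density_def
    by (intro Limsup_bounded eventually_mono[OF eventually_ge_at_top[of 1]])
  also have "\<dots> < \<infinity>"
    using fin by (auto simp: ennreal_mult_less_top)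
  finally show "upper_Beurling_density I \<gamma> < \<infinity>" .
qed

section \<open>Translates in shrinking cubes\<close>

lemma
  fixes a :: "'a::euclidean_space"
  shows measurable_lebesgue_translation: "(\<lambda>x. x - a) \<in> lebesgue \<rightarrow>\<^sub>M lebesgue"
    and distr_lebesgue_translation: "distr lebesgue lebesgue (\<lambda>x. x - a) = lebesgue"
proof -
  have eq: "(\<lambda>x. - a + (\<Sum>j\<in>Basis. (1 * (x \<bullet> j)) *\<^sub>R j)) = (\<lambda>x. x - a)"
    by (simp add: euclidean_representation)
  show "(\<lambda>x. x - a) \<in> lebesgue \<rightarrow>\<^sub>M lebesgue"
    using lebesgue_affine_measurable[of "\<lambda>_. 1" "- a"] unfolding eq by simp
  have "lebesgue = density (distr lebesgue lebesgue (\<lambda>x. x - a)) (\<lambda>_. 1)"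
    using lebesgue_affine_euclidean[of "\<lambda>_. 1" "- a"] unfolding eq by simp
  then show "distr lebesgue lebesgue (\<lambda>x. x - a) = lebesgue"
    by (simp add: density_1)
qed

lemma nn_integral_lebesgue_translation:
  fixes a :: "'a::euclidean_space"
  assumes "F \<in> borel_measurable lebesgue"
  shows "(\<integral>\<^sup>+x. F (x - a) \<partial>lebesgue) = (\<integral>\<^sup>+x. F x \<partial>lebesgue)"
proof -
  have "(\<integral>\<^sup>+x. F x \<partial>distr lebesgue lebesgue (\<lambda>x. x - a)) = (\<integral>\<^sup>+x. F (x - a) \<partial>lebesgue)"
    using assms by (intro nn_integral_distr measurable_lebesgue_translation) simp
  then show ?thesis by (simp only: distr_lebesgue_translation)
qed

lemma integral_lebesgue_translation:
  fixes a :: "'a::euclidean_space" and F :: "'a \<Rightarrow> complex"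
  assumes "F \<in> borel_measurable lebesgue"
  shows "(LINT x|lebesgue. F (x - a)) = (LINT x|lebesgue. F x)"
proof -
  have "(LINT x|distr lebesgue lebesgue (\<lambda>x. x - a). F x) = (LINT x|lebesgue. F (x - a))"
    using assms by (intro integral_distr measurable_lebesgue_translation)
  then show ?thesis by (simp only: distr_lebesgue_translation)
qed

lemma lmeasurable_cube:
  fixes x :: "real ^ 'd"
  shows "cube h x \<in> lmeasurable"
proof (rule bounded_set_imp_lmeasurable)
  have "cube h x \<subseteq> cbox (\<chi> i. x $ i - h / 2) (\<chi> i. x $ i + h / 2)"
    by (clarsimp simp: cube_def mem_box_cart less_imp_le)
  then show "bounded (cube h x)"
    using bounded_cbox bounded_subset by blast
  have "{y :: real ^ 'd. c \<le> y $ i} \<in> sets borel" "{y :: real ^ 'd. y $ i < c} \<in> sets borel" for c i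
    by (rule borel_closed[OF closed_halfspace_component_ge_cart],
        rule borel_open[OF open_halfspace_component_lt_cart])
  then have "(\<Inter>i\<in>UNIV. {y. x $ i - h / 2 \<le> y $ i} \<inter> {y. y $ i < x $ i + h / 2}) \<in> sets borel"
    by (intro sets.finite_INT sets.Int) simp_all
  also have "(\<Inter>i\<in>UNIV. {y. x $ i - h / 2 \<le> y $ i} \<inter> {y. y $ i < x $ i + h / 2}) = cube h x"
    unfolding cube_def by blast
  finally show "cube h x \<in> sets lebesgue" by simp
qed

lemma emeasure_cube_pos:
  fixes x :: "real ^ 'd"
  assumes "h > 0"
  shows "emeasure lebesgue (cube h x) > 0"
proof -
  let ?b = "box (\<chi> i. x $ i - h / 2) (\<chi> i. x $ i + h / 2)"
  have "x $ i - h / 2 < x $ i + h / 2" for i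
    using assms by simp
  then have "0 < emeasure lebesgue ?b"
    by (auto simp: emeasure_lborel_box_eq Basis_vec_def inner_axis less_imp_le intro!: prod_pos)
  also have "?b \<subseteq> cube h x"
    by (clarsimp simp: cube_def mem_box_cart less_imp_le)
  then have "emeasure lebesgue ?b \<le> emeasure lebesgue (cube h x)"
    by (rule emeasure_mono) (rule fmeasurableD[OF lmeasurable_cube])
  finally show ?thesis .
qed

text \<open>
  The sides \<open>1 / (m + 1)\<close> let the cubes about a fixed point shrink to that point, starting with the
  unit cube.
\<close>

lemma eventually_notin_shrinking_cube:
  fixes z y :: "real ^ 'd"
  assumes "z \<noteq> y"
  shows "eventually (\<lambda>m. z \<notin> cube (1 / real (Suc m)) y) sequentially"
proof -
  from assms obtain i where i: "z $ i \<noteq> y $ i" by (auto simp: vec_eq_iff)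
  then have "eventually (\<lambda>m. 1 / real (Suc m) < \<bar>z $ i - y $ i\<bar>) sequentially"
    by (intro order_tendstoD(2)[OF LIMSEQ_Suc[OF lim_1_over_n]]) auto
  then show ?thesis
  proof eventually_elim
    case (elim m)
    define e where "e = 1 / real (Suc m)"
    have "e > 0" "e < \<bar>z $ i - y $ i\<bar>" using elim by (simp_all add: e_def)
    then have "\<not> (- (e / 2) \<le> z $ i - y $ i \<and> z $ i - y $ i < e / 2)"
      by argo
    then show ?case unfolding e_def[symmetric] mem_cube_iff by blast
  qed
qed

text \<open>
  Substituting \<open>y = x - \<gamma>\<^sub>i\<close> in each integral and exchanging sum and integral gives
  \<open>\<integral> F(y) N\<^sub>m(y) dy\<close>, where \<open>N\<^sub>m(y)\<close> counts the \<open>i\<close> for which \<open>\<gamma>\<^sub>i\<close> lies in the cube of side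
  \<open>1 / (m + 1)\<close> about \<open>-y\<close>. The counts are bounded by the count in unit cubes, so \<open>F\<close> times this
  bound is an integrable majorant. Unless \<open>-y\<close> is one of the countably many \<open>\<gamma>\<^sub>i\<close>, the finitely many
  points in the unit cube about \<open>-y\<close> all leave the shrinking cubes, so \<open>N\<^sub>m(y)\<close> is eventually \<open>0\<close>.
  Dominated convergence applies.
\<close>

lemma translates_mass_in_shrinking_cubes_tendsto_0:
  fixes \<gamma> :: "'i \<Rightarrow> real ^ 'd" and F :: "real ^ 'd \<Rightarrow> ennreal"
  assumes "countable I" and fin: "upper_count I \<gamma> 1 < \<infinity>"
    and F[measurable]: "F \<in> borel_measurable lebesgue" and F_int: "(\<integral>\<^sup>+x. F x \<partial>lebesgue) < \<infinity>"
  shows "(\<lambda>m. \<integral>\<^sup>+i. (\<integral>\<^sup>+x. F (x - \<gamma> i) * indicator (cube (1 / real (Suc m)) 0) x \<partial>lebesgue)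
            \<partial>count_space I) \<longlonglongrightarrow> 0"
proof -
  define N where "N m y = emeasure (count_space I) {i \<in> I. \<gamma> i \<in> cube (1 / real (Suc m)) (- y)}"
    for m :: nat and y
  define G where "G m i y = F y * indicator (cube (1 / real (Suc m)) (- \<gamma> i)) y"
    for m :: nat and i y
  have [measurable]: "cube h x \<in> sets lebesgue" for h and x :: "real ^ 'd"
    using lmeasurable_cube by (auto simp: fmeasurable_def)
  have [measurable]: "G m i \<in> borel_measurable lebesgue" for m i
    unfolding G_def by measurable
  have shift: "(\<integral>\<^sup>+x. F (x - \<gamma> i) * indicator (cube (1 / real (Suc m)) 0) x \<partial>lebesgue)
      = (\<integral>\<^sup>+y. G m i y \<partial>lebesgue)" for m i
  proof -
    have "(\<integral>\<^sup>+x. F (x - \<gamma> i) * indicator (cube (1 / real (Suc m)) 0) x \<partial>lebesgue)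
        = (\<integral>\<^sup>+x. G m i (x - \<gamma> i) \<partial>lebesgue)"
      unfolding G_def
      by (intro nn_integral_cong arg_cong2[where f="(*)"] refl)
        (simp add: indicator_def mem_cube_diff[of _ _ "- _"])
    then show ?thesis by (simp add: nn_integral_lebesgue_translation)
  qed
  have count: "(\<integral>\<^sup>+i. G m i y \<partial>count_space I) = F y * N m y" for m y
  proof -
    have "(\<integral>\<^sup>+i. G m i y \<partial>count_space I)
        = (\<integral>\<^sup>+i. F y * indicator {i \<in> I. \<gamma> i \<in> cube (1 / real (Suc m)) (- y)} i \<partial>count_space I)"
      unfolding G_def
      by (intro nn_integral_cong arg_cong2[where f="(*)"] refl)
        (simp add: indicator_def mem_cube_diff[of _ _ "- _"] add.commute)
    then show ?thesis by (simp add: nn_integral_cmult N_def)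
  qed
  have meas: "(\<lambda>y. F y * N m y) \<in> borel_measurable lebesgue" for m
  proof -
    interpret sigma_finite_measure "count_space I"
      using \<open>countable I\<close> by (rule sigma_finite_measure_count_space_countable)
    have "(\<lambda>y. \<integral>\<^sup>+i. G m i y \<partial>count_space I) \<in> borel_measurable lebesgue"
    proof (rule borel_measurable_nn_integral)
      have "(\<lambda>(i, y). G m i y) \<in> borel_measurable (count_space I \<Otimes>\<^sub>M lebesgue)"
        using \<open>countable I\<close> by (rule measurable_pair_measure_countable1) auto
      then show "(\<lambda>(y, i). G m i y) \<in> borel_measurable (lebesgue \<Otimes>\<^sub>M count_space I)"
        by (subst measurable_pair_swap_iff) (auto simp: case_prod_unfold)
    qed
    then show ?thesis by (simp add: count)
  qed
  have N_le: "N m y \<le> upper_count I \<gamma> 1" for m y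
  proof -
    have "N m y \<le> upper_count I \<gamma> (1 / real (Suc m))"
      unfolding N_def upper_count_def by (rule SUP_upper) simp
    also have "\<dots> \<le> upper_count I \<gamma> 1" by (rule upper_count_mono) simp
    finally show ?thesis .
  qed
  have "AE y in lebesgue. y \<notin> uminus ` \<gamma> ` I"
    using \<open>countable I\<close> by (intro AE_not_in null_sets_completionI countable_imp_null_set_lborel) auto
  then have lim: "AE y in lebesgue. (\<lambda>m. F y * N m y) \<longlonglongrightarrow> 0"
  proof eventually_elim
    case (elim y)
    let ?S = "{i \<in> I. \<gamma> i \<in> cube 1 (- y)}"
    have "N 0 y < \<infinity>" using N_le[of 0 y] fin by (auto intro: le_less_trans)
    then have "finite ?S"
      unfolding N_def by (cases "finite ?S") (auto simp: emeasure_count_space)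
    then have "eventually (\<lambda>m. \<forall>i\<in>?S. \<gamma> i \<notin> cube (1 / real (Suc m)) (- y)) sequentially"
      using elim by (intro eventually_ball_finite ballI eventually_notin_shrinking_cube) (auto simp: image_iff)
    then have "eventually (\<lambda>m. F y * N m y = 0) sequentially"
    proof eventually_elim
      case (elim m)
      have "cube (1 / real (Suc m)) (- y) \<subseteq> cube 1 (- y)" by (rule cube_mono) simp
      then have "{i \<in> I. \<gamma> i \<in> cube (1 / real (Suc m)) (- y)} = {}"
        using elim by blast
      then have "N m y = 0" unfolding N_def by (metis emeasure_empty)
      then show ?case by simp
    qed
    then show ?case by (rule tendsto_eventually)
  qed
  have "(\<lambda>m. \<integral>\<^sup>+y. F y * N m y \<partial>lebesgue) \<longlonglongrightarrow> (\<integral>\<^sup>+y. 0 \<partial>(lebesgue :: (real^'d) measure))"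
  proof (rule nn_integral_dominated_convergence[where w = "\<lambda>y. F y * upper_count I \<gamma> 1"])
    show "AE y in lebesgue. F y * N m y \<le> F y * upper_count I \<gamma> 1" for m
      by (intro AE_I2 mult_left_mono N_le) auto
    show "(\<integral>\<^sup>+y. F y * upper_count I \<gamma> 1 \<partial>lebesgue) < \<infinity>"
      using F_int fin by (simp add: nn_integral_multc ennreal_mult_less_top)
  qed (use meas lim in auto)
  also have "(\<lambda>m. \<integral>\<^sup>+y. F y * N m y \<partial>lebesgue)
     = (\<lambda>m. \<integral>\<^sup>+i. (\<integral>\<^sup>+x. F (x - \<gamma> i) * indicator (cube (1 / real (Suc m)) 0) x \<partial>lebesgue)
            \<partial>count_space I)"
    unfolding shift count[symmetric] using \<open>countable I\<close>
    by (subst nn_integral_count_space_nn_integral) auto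
  finally show ?thesis by simp
qed

section \<open>Hoelder's inequality and \<open>L\<^sup>p\<close> functions\<close>

text \<open>
  Young's inequality is applied to the summands after both families have been normalised.
\<close>

lemma Holder_inequality_sum:
  fixes a b :: "'i \<Rightarrow> real"
  assumes "p > 1" "q > 1" "1 / p + 1 / q = 1"
    and nonneg: "\<And>i. i \<in> F \<Longrightarrow> a i \<ge> 0" "\<And>i. i \<in> F \<Longrightarrow> b i \<ge> 0"
  shows "(\<Sum>i\<in>F. a i * b i) \<le> (\<Sum>i\<in>F. a i powr p) powr (1 / p) * (\<Sum>i\<in>F. b i powr q) powr (1 / q)"
proof (cases "finite F")
  case True
  define A where "A = (\<Sum>i\<in>F. a i powr p) powr (1 / p)"
  define B where "B = (\<Sum>i\<in>F. b i powr q) powr (1 / q)"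
  show ?thesis
  proof (cases "A = 0 \<or> B = 0")
    case True
    then have "(\<forall>i\<in>F. a i = 0) \<or> (\<forall>i\<in>F. b i = 0)"
      using \<open>finite F\<close> by (auto simp: A_def B_def sum_nonneg_eq_0_iff)
    then have "(\<Sum>i\<in>F. a i * b i) = 0" by auto
    then show ?thesis by simp
  next
    case False
    then have pos: "A > 0" "B > 0"
      by (simp_all add: A_def B_def)
    have Ap: "A powr p = (\<Sum>i\<in>F. a i powr p)" and Bq: "B powr q = (\<Sum>i\<in>F. b i powr q)"
      using assms by (simp_all add: A_def B_def powr_powr sum_nonneg)
    have "(\<Sum>i\<in>F. (a i / A) * (b i / B)) \<le> (\<Sum>i\<in>F. (a i / A) powr p / p + (b i / B) powr q / q)"
      using assms pos by (intro sum_mono Youngs_inequality) auto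
    also have "\<dots> = (\<Sum>i\<in>F. a i powr p) / A powr p / p + (\<Sum>i\<in>F. b i powr q) / B powr q / q"
      using nonneg pos by (simp add: sum.distrib powr_divide sum_divide_distrib)
    also have "\<dots> = 1"
      using pos assms(3) by (simp flip: Ap Bq)
    finally have "(\<Sum>i\<in>F. (a i * b i) / (A * B)) \<le> 1"
      by simp
    then have "(\<Sum>i\<in>F. a i * b i) \<le> A * B"
      using pos by (simp flip: sum_divide_distrib add: field_simps)
    then show ?thesis by (simp add: A_def B_def)
  qed
qed simp

lemma powr_add_le:
  fixes a b p :: real
  assumes "0 \<le> a" "0 \<le> b" "0 \<le> p"
  shows "(a + b) powr p \<le> 2 powr p * (a powr p + b powr p)"
proof -
  have "(a + b) powr p \<le> (2 * max a b) powr p"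
    using assms by (intro powr_mono2) auto
  also have "\<dots> = 2 powr p * max a b powr p"
    using assms by (intro powr_mult)
  also have "\<dots> \<le> 2 powr p * (a powr p + b powr p)"
    by (intro mult_left_mono) (auto simp: max_def)
  finally show ?thesis .
qed

lemma Lp_add:
  assumes "p > 0" "f \<in> Lp p" "g \<in> Lp p"
  shows "(\<lambda>x. f x + g x) \<in> Lp p"
proof -
  have [measurable]: "f \<in> borel_measurable lebesgue" "g \<in> borel_measurable lebesgue"
    using assms by (auto simp: Lp_def)
  have "integrable lebesgue (\<lambda>x. norm (f x + g x) powr p)"
  proof (rule Bochner_Integration.integrable_bound)
    show "integrable lebesgue (\<lambda>x. 2 powr p * (norm (f x) powr p + norm (g x) powr p))"
      using assms by (auto simp: Lp_def)
    have "norm (f x + g x) powr p \<le> 2 powr p * (norm (f x) powr p + norm (g x) powr p)" for x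
    proof -
      have "norm (f x + g x) powr p \<le> (norm (f x) + norm (g x)) powr p"
        using assms by (intro powr_mono2 norm_triangle_ineq) auto
      also have "\<dots> \<le> 2 powr p * (norm (f x) powr p + norm (g x) powr p)"
        using assms by (intro powr_add_le) auto
      finally show ?thesis .
    qed
    then show "AE x in lebesgue. norm (norm (f x + g x) powr p)
        \<le> norm (2 powr p * (norm (f x) powr p + norm (g x) powr p))"
      by (intro AE_I2) (simp add: order_trans[OF _ abs_ge_self])
  qed measurable
  then show ?thesis by (simp add: Lp_def)
qed

lemma Lp_cmult: "f \<in> Lp p \<Longrightarrow> (\<lambda>x. c * f x) \<in> Lp p"
  by (auto simp: Lp_def norm_mult powr_mult)

lemma Lp_sum:
  assumes "p > 0" "\<And>j. j \<in> F \<Longrightarrow> g j \<in> Lp p"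
  shows "(\<lambda>x. \<Sum>j\<in>F. g j x) \<in> Lp p"
proof (cases "finite F")
  case True
  then show ?thesis using assms(2)
  proof (induction F)
    case empty
    then show ?case by (simp add: Lp_def)
  next
    case (insert j F)
    then show ?case using Lp_add[OF \<open>p > 0\<close>, of "g j"] by simp
  qed
qed (simp add: Lp_def)

lemma
  assumes "S \<in> lmeasurable" "p > 0"
  shows indicator_in_Lp: "(\<lambda>x. complex_of_real (indicator S x)) \<in> Lp p"
    and Lp_norm_indicator: "Lp_norm p (\<lambda>x. complex_of_real (indicator S x)) = measure lebesgue S powr (1 / p)"
proof -
  have eq: "norm (complex_of_real (indicator S x)) powr p = indicator S x" for x
    using assms by (simp add: indicator_def)
  show "(\<lambda>x. complex_of_real (indicator S x)) \<in> Lp p"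
    using assms unfolding Lp_def mem_Collect_eq eq
    by (auto simp: fmeasurable_def)
  show "Lp_norm p (\<lambda>x. complex_of_real (indicator S x)) = measure lebesgue S powr (1 / p)"
    using assms unfolding Lp_norm_def eq by simp
qed

text \<open>
  On a set of finite measure \<open>|f|\<close> has the integrable majorant \<open>1 + |f|\<^sup>p\<close>.
\<close>

lemma Lp_set_integrable:
  assumes "f \<in> Lp p" "p \<ge> 1" "S \<in> lmeasurable"
  shows "set_integrable lebesgue S f"
  unfolding set_integrable_def
proof (rule Bochner_Integration.integrable_bound)
  have [measurable]: "f \<in> borel_measurable lebesgue" "S \<in> sets lebesgue"
    using assms by (auto simp: Lp_def)
  show "integrable lebesgue (\<lambda>x. indicator S x + norm (f x) powr p)"
    using assms by (intro Bochner_Integration.integrable_add) (auto simp: Lp_def fmeasurable_def)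
  have "t \<le> 1 + t powr p" if "t \<ge> 0" for t :: real
  proof (cases "t \<ge> 1")
    case True
    then have "t powr 1 \<le> t powr p" using assms by (intro powr_mono)
    then show ?thesis using True by simp
  next
    case False
    then show ?thesis by (smt (verit) powr_ge_zero)
  qed
  then have "norm (indicator S x *\<^sub>R f x) \<le> norm (indicator S x + norm (f x) powr p)" for x
    by (auto simp: indicator_def)
  then show "AE x in lebesgue. norm (indicator S x *\<^sub>R f x) \<le> norm (indicator S x + norm (f x) powr p)"
    by simp
  show "(\<lambda>x. indicator S x *\<^sub>R f x) \<in> borel_measurable lebesgue"
    by measurable
qed

section \<open>\<open>(C\<^sub>r)\<close>-systems\<close>

text \<open>
  Let \<open>v\<close> be the measure of \<open>Q\<close> and approximate its indicator function by \<open>s = \<Sum>\<^sub>j a\<^sub>j g\<^sub>j\<close>. Since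
  the \<open>\<ell>\<^sup>q\<close> norm of \<open>a\<close> is at most \<open>C v\<^bsup>1/p\<^esup>\<close>, Hoelder's inequality gives
  \<open>|s|\<^sup>p \<le> C\<^sup>p v \<Sum>\<^sub>j |g\<^sub>j|\<^sup>p\<close> at every point. On \<open>Q\<close> the constant \<open>1\<close> is the sum of \<open>s\<close> and the
  remainder \<open>r\<close>, so integrating \<open>1 \<le> 2\<^sup>p (|r|\<^sup>p + |s|\<^sup>p)\<close> over \<open>Q\<close> bounds \<open>v\<close> by a small
  multiple of \<open>v\<close> plus a constant times \<open>v \<Sum>\<^sub>j \<integral>\<^sub>Q |g\<^sub>j|\<^sup>p\<close>. The factor \<open>v\<close> cancels, which is why
  the bound is uniform in \<open>Q\<close>.
\<close>

lemma C_system_local_mass_bound: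
  fixes g :: "'j \<Rightarrow> real ^ 'd \<Rightarrow> complex"
  assumes pq: "p > 1" "q > 1" "1 / p + 1 / q = 1" and C: "C_system p q J g"
  obtains K :: real where "\<And>Q. Q \<in> lmeasurable \<Longrightarrow> emeasure lebesgue Q > 0 \<Longrightarrow>
    1 \<le> ennreal K *
      (\<integral>\<^sup>+j. (\<integral>\<^sup>+x. ennreal (norm (g j x) powr p) * indicator Q x \<partial>lebesgue) \<partial>count_space J)"
proof -
  from C obtain C where gLp: "\<And>j. j \<in> J \<Longrightarrow> g j \<in> Lp p" and "C > 0"
    and approx: "\<And>f \<epsilon>. f \<in> Lp p \<Longrightarrow> \<epsilon> > 0 \<Longrightarrow> \<exists>F a. finite F \<and> F \<subseteq> J \<and>
        Lp_norm p (\<lambda>x. f x - (\<Sum>j\<in>F. a j * g j x)) < \<epsilon> \<and>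
        (\<Sum>j\<in>F. norm (a j) powr q) powr (1 / q) \<le> C * Lp_norm p f"
    unfolding C_system_def by blast
  have "1 \<le> ennreal (2 * (2 powr p * C powr p)) *
      (\<integral>\<^sup>+j. (\<integral>\<^sup>+x. ennreal (norm (g j x) powr p) * indicator Q x \<partial>lebesgue) \<partial>count_space J)"
    (is "1 \<le> ennreal (2 * ?D) * ?S")
    if Q: "Q \<in> lmeasurable" "emeasure lebesgue Q > 0" for Q
  proof -
    define v where "v = measure lebesgue Q"
    have emQ: "emeasure lebesgue Q = ennreal v"
      unfolding v_def using Q by (simp add: emeasure_eq_measure2)
    have "v > 0" using Q(2) by (simp add: emQ)
    define f :: "real ^ 'd \<Rightarrow> complex" where "f = (\<lambda>x. complex_of_real (indicator Q x))"
    have f: "f \<in> Lp p" "Lp_norm p f = v powr (1 / p)"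
      unfolding f_def v_def using Q pq by (auto intro: indicator_in_Lp Lp_norm_indicator)
    \<comment> \<open>With tolerance \<open>v\<^bsup>1/p\<^esup> / 4\<close> the remainder contributes at most
      \<open>2\<^sup>p v / 4\<^sup>p = v / 2\<^sup>p \<le> v / 2\<close>.\<close>
    obtain F a where F: "finite F" "F \<subseteq> J"
      and close: "Lp_norm p (\<lambda>x. f x - (\<Sum>j\<in>F. a j * g j x)) < v powr (1 / p) / 4"
      and coeff: "(\<Sum>j\<in>F. norm (a j) powr q) powr (1 / q) \<le> C * v powr (1 / p)"
      using approx[OF f(1), of "v powr (1 / p) / 4"] \<open>v > 0\<close> unfolding f(2) by auto
    define r where "r x = f x - (\<Sum>j\<in>F. a j * g j x)" for x
    have rLp: "r \<in> Lp p"
    proof -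
      have "(\<lambda>x. f x + (\<Sum>j\<in>F. (- a j) * g j x)) \<in> Lp p"
        using F gLp f pq by (intro Lp_add Lp_sum Lp_cmult) auto
      then show ?thesis by (simp add: r_def[abs_def] sum_negf)
    qed
    have [measurable]: "r \<in> borel_measurable lebesgue" "Q \<in> sets lebesgue"
      "\<And>j. j \<in> F \<Longrightarrow> g j \<in> borel_measurable lebesgue"
      using rLp Q gLp F by (auto simp: Lp_def)
    have r_small: "(\<integral>\<^sup>+x. ennreal (norm (r x) powr p) \<partial>lebesgue) \<le> ennreal (v * (1 / 4) powr p)"
    proof -
      have int: "integrable lebesgue (\<lambda>x. norm (r x) powr p)"
        using rLp by (simp add: Lp_def)
      let ?I = "LINT x|lebesgue. norm (r x) powr p"
      have "?I \<ge> 0" by (rule integral_nonneg_AE) simp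
      then have "?I = (?I powr (1 / p)) powr p"
        using pq by (simp add: powr_powr)
      also have "\<dots> \<le> (v powr (1 / p) / 4) powr p"
        using close pq unfolding Lp_norm_def r_def by (intro powr_mono2) auto
      also have "\<dots> = v * (1 / 4) powr p"
        using pq \<open>v > 0\<close> by (simp add: powr_divide powr_powr)
      finally show ?thesis
        using int by (simp add: nn_integral_eq_integral ennreal_leI)
    qed
    have pointwise: "indicator Q x \<le> ennreal (2 powr p) * ennreal (norm (r x) powr p)
        + ennreal (?D * v) * (\<Sum>j\<in>F. ennreal (norm (g j x) powr p) * indicator Q x)" for x
    proof (cases "x \<in> Q")
      case True
      let ?s = "\<Sum>j\<in>F. a j * g j x"
      let ?G = "\<Sum>j\<in>F. norm (g j x) powr p"
      have "norm ?s \<le> (\<Sum>j\<in>F. norm (a j) * norm (g j x))"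
        by (rule sum_norm_le) (simp add: norm_mult)
      also have "\<dots> \<le> (\<Sum>j\<in>F. norm (a j) powr q) powr (1 / q) * ?G powr (1 / p)"
        using pq by (intro Holder_inequality_sum) auto
      also have "\<dots> \<le> C * v powr (1 / p) * ?G powr (1 / p)"
        by (intro mult_right_mono coeff) simp
      finally have "norm ?s powr p \<le> (C * v powr (1 / p) * ?G powr (1 / p)) powr p"
        using pq by (intro powr_mono2) auto
      also have "\<dots> = C powr p * v * ?G"
        using pq \<open>C > 0\<close> \<open>v > 0\<close> by (simp add: powr_mult powr_powr sum_nonneg)
      finally have s: "norm ?s powr p \<le> C powr p * v * ?G" .
      have "1 = norm (r x + ?s)"
        using True by (simp add: r_def f_def)
      also have "\<dots> \<le> norm (r x) + norm ?s"
        by (rule norm_triangle_ineq)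
      finally have "1 \<le> (norm (r x) + norm ?s) powr p"
        using pq by (intro ge_one_powr_ge_zero) auto
      also have "\<dots> \<le> 2 powr p * (norm (r x) powr p + norm ?s powr p)"
        using pq by (intro powr_add_le) auto
      also have "\<dots> \<le> 2 powr p * (norm (r x) powr p + C powr p * v * ?G)"
        using s by (intro mult_left_mono add_left_mono) auto
      also have "\<dots> = 2 powr p * norm (r x) powr p + (?D * v) * ?G"
        by (simp add: algebra_simps)
      finally have "ennreal 1 \<le> ennreal (2 powr p * norm (r x) powr p + (?D * v) * ?G)"
        by (rule ennreal_leI)
      also have "\<dots> = ennreal (2 powr p) * ennreal (norm (r x) powr p)
          + ennreal (?D * v) * ennreal ?G"
        using \<open>v > 0\<close> by (simp add: ennreal_plus ennreal_mult sum_nonneg)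
      finally show ?thesis
        using True by (simp add: sum_ennreal)
    qed simp
    have "ennreal v = (\<integral>\<^sup>+x. indicator Q x \<partial>lebesgue)"
      by (simp add: emQ)
    also have "\<dots> \<le> (\<integral>\<^sup>+x. ennreal (2 powr p) * ennreal (norm (r x) powr p)
        + ennreal (?D * v) * (\<Sum>j\<in>F. ennreal (norm (g j x) powr p) * indicator Q x) \<partial>lebesgue)"
      by (intro nn_integral_mono pointwise)
    also have "\<dots> = ennreal (2 powr p) * (\<integral>\<^sup>+x. ennreal (norm (r x) powr p) \<partial>lebesgue)
        + ennreal (?D * v) *
          (\<Sum>j\<in>F. (\<integral>\<^sup>+x. ennreal (norm (g j x) powr p) * indicator Q x \<partial>lebesgue))"
      by (simp add: nn_integral_add nn_integral_cmult nn_integral_sum)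
    also have "\<dots> \<le> ennreal (v / 2) + ennreal (?D * v) * ?S"
    proof (intro add_mono mult_left_mono)
      have "ennreal (2 powr p) * (\<integral>\<^sup>+x. ennreal (norm (r x) powr p) \<partial>lebesgue)
          \<le> ennreal (2 powr p) * ennreal (v * (1 / 4) powr p)"
        by (intro mult_left_mono r_small) simp
      also have "\<dots> = ennreal (v * (1 / 2) powr p)"
      proof -
        have "2 powr p * (1 / 4) powr p = (1 / 2 :: real) powr p"
          by (subst powr_mult[symmetric]) auto
        then show ?thesis using \<open>v > 0\<close> by (simp flip: ennreal_mult add: mult_ac)
      qed
      also have "\<dots> \<le> ennreal (v / 2)"
      proof (rule ennreal_leI)
        have "(1 / 2 :: real) powr p \<le> (1 / 2) powr 1"
          using pq by (intro powr_mono') auto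
        then show "v * (1 / 2) powr p \<le> v / 2" using \<open>v > 0\<close> by simp
      qed
      finally show "ennreal (2 powr p) * (\<integral>\<^sup>+x. ennreal (norm (r x) powr p) \<partial>lebesgue) \<le> ennreal (v / 2)" .
      have "(\<Sum>j\<in>F. (\<integral>\<^sup>+x. ennreal (norm (g j x) powr p) * indicator Q x \<partial>lebesgue))
          = (\<integral>\<^sup>+j. (\<integral>\<^sup>+x. ennreal (norm (g j x) powr p) * indicator Q x \<partial>lebesgue)
               * indicator F j \<partial>count_space J)"
        using F by (subst nn_integral_count_space'[of F]) auto
      also have "\<dots> \<le> ?S"
        by (intro nn_integral_mono) (simp add: indicator_def)
      finally show "(\<Sum>j\<in>F. (\<integral>\<^sup>+x. ennreal (norm (g j x) powr p) * indicator Q x \<partial>lebesgue)) \<le> ?S" .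
    qed simp
    finally have main: "ennreal v \<le> ennreal (v / 2) + ennreal (?D * v) * ?S" .
    show ?thesis
    proof (cases ?S)
      case (real s)
      have "ennreal (v / 2) + ennreal (?D * v) * ?S = ennreal (v / 2 + ?D * v * s)"
        using real \<open>v > 0\<close> by (simp add: ennreal_plus ennreal_mult)
      with main have "ennreal v \<le> ennreal (v / 2 + ?D * v * s)"
        by (simp only:)
      moreover have "0 \<le> v / 2 + ?D * v * s"
        using real \<open>v > 0\<close> by simp
      ultimately have "v \<le> v / 2 + ?D * v * s"
        by (simp only: ennreal_le_iff)
      then have "v * 1 \<le> v * (2 * ?D * s)"
        by (simp add: algebra_simps)
      then have "1 \<le> 2 * ?D * s"
        using \<open>v > 0\<close> by (simp only: mult_le_cancel_left_pos)
      then have "ennreal 1 \<le> ennreal (2 * ?D * s)"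
        by (rule ennreal_leI)
      then show ?thesis using real by (simp add: ennreal_mult)
    next
      case top
      then show ?thesis using \<open>C > 0\<close> by (simp add: ennreal_mult_top)
    qed
  qed
  then show ?thesis by (rule that)
qed

text \<open>
  The family is dominated by translates of a single integrable \<open>F\<close>. This covers finitely many
  generators at once, with the sum of the \<open>|f\<^sub>k|\<^sup>p\<close> in the role of \<open>F\<close>.
\<close>

lemma C_system_imp_upper_count_infinite:
  fixes g :: "'j \<Rightarrow> real ^ 'd \<Rightarrow> complex" and \<Gamma> :: "'j \<Rightarrow> real ^ 'd"
  assumes pq: "p > 1" "q > 1" "1 / p + 1 / q = 1" and C: "C_system p q J g"
    and F: "F \<in> borel_measurable lebesgue" "(\<integral>\<^sup>+x. F x \<partial>lebesgue) < \<infinity>"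
    and dom: "\<And>j x. j \<in> J \<Longrightarrow> ennreal (norm (g j x) powr p) \<le> F (x - \<Gamma> j)"
  shows "upper_count J \<Gamma> 1 = \<infinity>"
proof (rule ccontr)
  assume "upper_count J \<Gamma> 1 \<noteq> \<infinity>"
  then have fin: "upper_count J \<Gamma> 1 < \<infinity>" by (simp add: less_top)
  have J: "countable J" using C by (simp add: C_system_def)
  define T where "T m = (\<integral>\<^sup>+j. (\<integral>\<^sup>+x. F (x - \<Gamma> j) * indicator (cube (1 / real (Suc m)) 0) x \<partial>lebesgue)
      \<partial>count_space J)" for m
  have T: "T \<longlonglongrightarrow> 0"
    unfolding T_def by (rule translates_mass_in_shrinking_cubes_tendsto_0[OF J fin F])
  obtain K where K: "\<And>Q. Q \<in> lmeasurable \<Longrightarrow> emeasure lebesgue Q > 0 \<Longrightarrow>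
    1 \<le> ennreal K *
      (\<integral>\<^sup>+j. (\<integral>\<^sup>+x. ennreal (norm (g j x) powr p) * indicator Q x \<partial>lebesgue) \<partial>count_space J)"
    using C_system_local_mass_bound[OF pq C] by blast
  have "1 \<le> ennreal K * T m" for m
  proof -
    let ?Q = "cube (1 / real (Suc m)) (0 :: real ^ 'd)"
    have "1 \<le> ennreal K *
      (\<integral>\<^sup>+j. (\<integral>\<^sup>+x. ennreal (norm (g j x) powr p) * indicator ?Q x \<partial>lebesgue) \<partial>count_space J)"
      by (intro K lmeasurable_cube emeasure_cube_pos) simp
    also have "\<dots> \<le> ennreal K * T m"
      unfolding T_def by (intro mult_left_mono nn_integral_mono mult_right_mono dom) auto
    finally show ?thesis .
  qed
  moreover have "(\<lambda>m. ennreal K * T m) \<longlonglongrightarrow> ennreal K * 0"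
    by (intro ennreal_tendsto_cmult T) simp
  ultimately have "1 \<le> ennreal K * 0"
    by (intro tendsto_lowerbound[of _ _ sequentially]) auto
  then show False by simp
qed

section \<open>Bessel sequences\<close>

text \<open>
  By Lebesgue differentiation \<open>f(x)\<close> is, for almost every \<open>x\<close>, the limit of averages of \<open>f\<close> over
  small boxes with corner \<open>x\<close>. If all box integrals vanished, \<open>f\<close> would vanish almost everywhere.
\<close>

lemma exists_box_integral_nonzero:
  fixes f :: "'a::euclidean_space \<Rightarrow> 'b::euclidean_space"
  assumes int: "\<And>a b. set_integrable lebesgue (cbox a b) f"
    and nz: "\<not> (AE x in lebesgue. f x = 0)"
  obtains a b where "(LINT x:cbox a b|lebesgue. f x) \<noteq> 0"
proof (rule ccontr)
  assume "\<not> thesis"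
  then have zero: "(LINT x:cbox a b|lebesgue. f x) = 0" for a b
    using that by blast
  have "f integrable_on cbox a b" for a b
    using set_lebesgue_integral_eq_integral(1)[OF int] .
  then obtain N where N: "negligible N"
    and diff: "\<And>x e. x \<notin> N \<Longrightarrow> 0 < e \<Longrightarrow> \<exists>d>0. \<forall>h. 0 < h \<and> h < d \<longrightarrow>
        norm (integral (cbox x (x + h *\<^sub>R One)) f /\<^sub>R h ^ DIM('a) - f x) < e"
    using integrable_ccontinuous_explicit[of f] by blast
  have "f x = 0" if x: "x \<notin> N" for x
  proof (rule ccontr)
    assume "f x \<noteq> 0"
    then obtain d where "d > 0" and d: "\<And>h. 0 < h \<Longrightarrow> h < d \<Longrightarrow>
        norm (integral (cbox x (x + h *\<^sub>R One)) f /\<^sub>R h ^ DIM('a) - f x) < norm (f x)"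
      using diff[OF x, of "norm (f x)"] by auto
    from d[of "d / 2"] \<open>d > 0\<close> show False
      using zero set_lebesgue_integral_eq_integral(2)[OF int] by simp
  qed
  moreover have "AE x in lebesgue. x \<notin> N"
    using N by (intro AE_not_in) (simp add: negligible_iff_null_sets)
  ultimately have "AE x in lebesgue. f x = 0"
    by (auto elim: eventually_mono)
  with nz show False ..
qed

text \<open>
  The indicator functions of the translated boxes converge off the boundary of the box, which is a
  null set, and all these boxes lie in the box enlarged by \<open>1\<close> on every side. So dominated
  convergence applies.
\<close>

lemma tendsto_integral_translated_box:
  fixes f :: "real ^ 'd \<Rightarrow> complex"
  assumes int: "\<And>a b. set_integrable lebesgue (cbox a b) f"
    and f: "f \<in> borel_measurable lebesgue"
    and s: "s \<longlonglongrightarrow> 0" and s1: "\<And>n. norm (s n) \<le> 1"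
  shows "(\<lambda>n. LINT x:cbox (a + s n) (b + s n)|lebesgue. f x) \<longlonglongrightarrow> (LINT x:cbox a b|lebesgue. f x)"
  unfolding set_lebesgue_integral_def
proof (rule integral_dominated_convergence)
  let ?c = "cbox (a - 1) (b + 1)"
  show "integrable lebesgue (\<lambda>x. norm (indicator ?c x *\<^sub>R f x))"
    using int[of "a - 1" "b + 1"] unfolding set_integrable_def by (rule integrable_norm)
  have sub: "cbox (a + s n) (b + s n) \<subseteq> ?c" for n
  proof
    fix x assume "x \<in> cbox (a + s n) (b + s n)"
    then have "a $ i + s n $ i \<le> x $ i \<and> x $ i \<le> b $ i + s n $ i" for i
      by (simp add: mem_box_cart)
    moreover have "\<bar>s n $ i\<bar> \<le> 1" for i
      using component_le_norm_cart[of "s n" i] s1[of n] by linarith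
    ultimately have "a $ i - 1 \<le> x $ i \<and> x $ i \<le> b $ i + 1" for i
      by (smt (verit))
    then show "x \<in> ?c" by (simp add: mem_box_cart)
  qed
  then show "AE x in lebesgue. norm (indicator (cbox (a + s n) (b + s n)) x *\<^sub>R f x)
      \<le> norm (indicator ?c x *\<^sub>R f x)" for n
    by (intro AE_I2) (auto simp: indicator_def)
  have "AE x in lebesgue. x \<notin> cbox a b - box a b"
    using negligible_frontier_interval[of a b] by (intro AE_not_in) (simp add: negligible_iff_null_sets)
  then show "AE x in lebesgue. (\<lambda>n. indicator (cbox (a + s n) (b + s n)) x *\<^sub>R f x)
      \<longlonglongrightarrow> indicator (cbox a b) x *\<^sub>R f x"
  proof eventually_elim
    case (elim x)
    have mem: "x \<in> cbox (a + s n) (b + s n) \<longleftrightarrow> x - s n \<in> cbox a b" for n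
      by (simp add: mem_box_cart algebra_simps)
    have lim: "(\<lambda>n. x - s n) \<longlonglongrightarrow> x"
      using tendsto_diff[OF tendsto_const s, of x] by simp
    have "eventually (\<lambda>n. x - s n \<in> cbox a b \<longleftrightarrow> x \<in> cbox a b) sequentially"
    proof (cases "x \<in> cbox a b")
      case True
      with elim have "x \<in> box a b" by blast
      then have "eventually (\<lambda>n. x - s n \<in> box a b) sequentially"
        by (intro topological_tendstoD[OF lim] open_box)
      then show ?thesis
        by eventually_elim (use True box_subset_cbox in blast)
    next
      case False
      then have "eventually (\<lambda>n. x - s n \<in> - cbox a b) sequentially"
        by (intro topological_tendstoD[OF lim]) auto
      then show ?thesis
        by eventually_elim (use False in auto)
    qed
    then have "eventually (\<lambda>n. indicator (cbox (a + s n) (b + s n)) x *\<^sub>R f x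
        = indicator (cbox a b) x *\<^sub>R f x) sequentially"
      by eventually_elim (simp add: indicator_def mem)
    then show ?case by (rule tendsto_eventually)
  qed
qed (intro borel_measurable_scaleR borel_measurable_indicator f; simp)+

text \<open>
  Half the modulus of a nonzero box integral serves as the lower bound \<open>c\<close>: by continuity it
  survives small translations.
\<close>

lemma integral_translated_box_bounded_below:
  fixes f :: "real ^ 'd \<Rightarrow> complex"
  assumes "f \<in> Lp p" "p \<ge> 1" "\<not> (AE x in lebesgue. f x = 0)"
  obtains a b c \<delta> where "c > 0" "\<delta> > 0"
    "\<And>s. norm s < \<delta> \<Longrightarrow> c \<le> norm (LINT x:cbox (a + s) (b + s)|lebesgue. f x)"
proof -
  have int: "set_integrable lebesgue (cbox a b) f" for a b
    using assms by (intro Lp_set_integrable) auto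
  have meas: "f \<in> borel_measurable lebesgue" using assms by (simp add: Lp_def)
  obtain a b where ab: "(LINT x:cbox a b|lebesgue. f x) \<noteq> 0" (is "?L \<noteq> 0")
    using exists_box_integral_nonzero[OF int assms(3)] .
  have "\<exists>\<delta>>0. \<forall>s. norm s < \<delta> \<longrightarrow> norm ?L / 2 \<le> norm (LINT x:cbox (a + s) (b + s)|lebesgue. f x)"
  proof (rule ccontr)
    assume *: "\<not> ?thesis"
    have "\<exists>s. norm s < 1 / real (Suc n) \<and>
        norm (LINT x:cbox (a + s) (b + s)|lebesgue. f x) \<le> norm ?L / 2" for n
    proof -
      have "1 / real (Suc n) > 0" by simp
      with * show ?thesis by (meson less_eq_real_def not_le)
    qed
    then obtain s where s: "\<And>n. norm (s n) < 1 / real (Suc n)"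
      "\<And>n. norm (LINT x:cbox (a + s n) (b + s n)|lebesgue. f x) \<le> norm ?L / 2"
      by metis
    have "s \<longlonglongrightarrow> 0"
    proof (rule Lim_null_comparison)
      show "eventually (\<lambda>n. norm (s n) \<le> 1 / real (Suc n)) sequentially"
        using s(1) by (intro always_eventually allI less_imp_le)
      show "(\<lambda>n. 1 / real (Suc n)) \<longlonglongrightarrow> 0"
        by (rule LIMSEQ_Suc[OF lim_1_over_n])
    qed
    moreover have "norm (s n) \<le> 1" for n
    proof -
      have "1 / real (Suc n) \<le> 1" by simp
      then show ?thesis using s(1)[of n] by linarith
    qed
    ultimately have "(\<lambda>n. norm (LINT x:cbox (a + s n) (b + s n)|lebesgue. f x)) \<longlonglongrightarrow> norm ?L"
      by (intro tendsto_norm tendsto_integral_translated_box int meas)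
    then have "norm ?L \<le> norm ?L / 2"
      using s(2) by (intro tendsto_upperbound[of _ _ sequentially]) auto
    then show False using ab by simp
  qed
  then obtain \<delta> where "\<delta> > 0"
    "\<And>s. norm s < \<delta> \<Longrightarrow> norm ?L / 2 \<le> norm (LINT x:cbox (a + s) (b + s)|lebesgue. f x)"
    by blast
  with ab show ?thesis by (intro that[of "norm ?L / 2" \<delta> a b]) auto
qed

text \<open>
  The test function at \<open>x\<close> is the indicator function of a fixed box translated by \<open>x\<close>. Its pairing
  with \<open>T\<^sub>\<gamma> f\<close> is the integral of \<open>f\<close> over the box translated by \<open>x - \<gamma>\<close>, and \<open>x - \<gamma>\<close> is small.
\<close>

lemma exists_uniform_test_functions:
  fixes f :: "real ^ 'd \<Rightarrow> complex"
  assumes "f \<in> Lp p" "p \<ge> 1" "\<not> (AE x in lebesgue. f x = 0)" "q > 0"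
  obtains c \<delta> M and h :: "real ^ 'd \<Rightarrow> real ^ 'd \<Rightarrow> complex" where "c > 0" "\<delta> > 0"
    "\<And>x. h x \<in> Lp q" "\<And>x. Lp_norm q (h x) = M"
    "\<And>x \<gamma>. \<gamma> \<in> cube \<delta> x \<Longrightarrow> c \<le> norm (dual_pairing (h x) (translate \<gamma> f))"
proof -
  obtain a b c \<rho> where "c > 0" "\<rho> > 0"
    and below: "\<And>s. norm s < \<rho> \<Longrightarrow> c \<le> norm (LINT x:cbox (a + s) (b + s)|lebesgue. f x)"
    using integral_translated_box_bounded_below assms(1-3) by metis
  have f: "f \<in> borel_measurable lebesgue" using assms by (simp add: Lp_def)
  define h where "h x = (\<lambda>y. complex_of_real (indicator (cbox (a + x) (b + x)) y))" for x
  \<comment> \<open>The absolute values of the coordinates sum to a bound of the norm, so points in the cube of this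
    side about \<open>x\<close> have distance less than \<open>\<rho>\<close> from \<open>x\<close>.\<close>
  define \<delta> where "\<delta> = \<rho> / real CARD('d)"
  have "\<delta> > 0" using \<open>\<rho> > 0\<close> by (simp add: \<delta>_def)
  show thesis
  proof (rule that[of c \<delta> h "measure lebesgue (cbox a b) powr (1 / q)"])
    fix x :: "real ^ 'd"
    show "h x \<in> Lp q"
      unfolding h_def using assms by (intro indicator_in_Lp) auto
    have "cbox (a + x) (b + x) = (+) x ` cbox a b"
      using cbox_translation[of x a b] by (simp add: add.commute)
    then have "measure lebesgue (cbox (a + x) (b + x)) = measure lebesgue (cbox a b)"
      by (simp add: measure_translation)
    moreover have "Lp_norm q (h x) = measure lebesgue (cbox (a + x) (b + x)) powr (1 / q)"
      unfolding h_def using assms by (intro Lp_norm_indicator) auto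
    ultimately show "Lp_norm q (h x) = measure lebesgue (cbox a b) powr (1 / q)"
      by simp
  next
    fix x \<gamma> :: "real ^ 'd" assume \<gamma>: "\<gamma> \<in> cube \<delta> x"
    have "norm (x - \<gamma>) \<le> (\<Sum>i\<in>UNIV. \<bar>(x - \<gamma>) $ i\<bar>)"
      by (rule norm_le_l1_cart)
    also have "\<dots> \<le> real CARD('d) * (\<delta> / 2)"
    proof (rule sum_bounded_above)
      fix i
      have "- (\<delta> / 2) \<le> \<gamma> $ i - x $ i \<and> \<gamma> $ i - x $ i < \<delta> / 2"
        using \<gamma> by (simp add: mem_cube_iff)
      then have "\<bar>x $ i - \<gamma> $ i\<bar> \<le> \<delta> / 2" by argo
      then show "\<bar>(x - \<gamma>) $ i\<bar> \<le> \<delta> / 2" by simp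
    qed
    also have "\<dots> < \<rho>" using \<open>\<rho> > 0\<close> by (simp add: \<delta>_def)
    finally have small: "norm (x - \<gamma>) < \<rho>" .
    define G where "G = (\<lambda>z. indicator (cbox (a + (x - \<gamma>)) (b + (x - \<gamma>))) z *\<^sub>R f z)"
    have G: "G \<in> borel_measurable lebesgue"
      unfolding G_def by (intro borel_measurable_scaleR borel_measurable_indicator f) simp
    have "dual_pairing (h x) (translate \<gamma> f) = (LINT y|lebesgue. G (y - \<gamma>))"
      unfolding dual_pairing_def h_def translate_def G_def
      by (intro Bochner_Integration.integral_cong)
         (auto simp: indicator_def mem_box_cart algebra_simps scaleR_conv_of_real)
    also have "\<dots> = (LINT z|lebesgue. G z)"
      by (rule integral_lebesgue_translation[OF G])
    finally show "c \<le> norm (dual_pairing (h x) (translate \<gamma> f))"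
      using below[OF small] by (simp add: G_def set_lebesgue_integral_def)
  qed fact+
qed

text \<open>
  Every \<open>j\<close> in \<open>J0\<close> with \<open>\<Gamma> j\<close> in the cube of side \<open>\<delta>\<close> about \<open>x\<close> contributes at least \<open>c\<^sup>r\<close> to the Bessel sum of the
  test function at \<open>x\<close>, and that sum is at most \<open>B M\<^sup>r\<close>. The subfamily \<open>J0\<close> collects the
  translates of one generator \<open>f\<close>; with several generators each has its own test functions.
\<close>

lemma Bessel_sequence_imp_upper_count_finite:
  fixes g :: "'j \<Rightarrow> real ^ 'd \<Rightarrow> complex" and \<Gamma> :: "'j \<Rightarrow> real ^ 'd"
  assumes Bessel: "Bessel_sequence p q r J g" and r: "r > 0"
    and f: "f \<in> Lp p" "p \<ge> 1" "\<not> (AE x in lebesgue. f x = 0)" "q > 0"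
    and J0: "J0 \<subseteq> J" "\<And>j. j \<in> J0 \<Longrightarrow> g j = translate (\<Gamma> j) f"
  shows "upper_count J0 \<Gamma> 1 < \<infinity>"
proof -
  obtain B where "B > 0" and B: "\<And>h. h \<in> Lp q \<Longrightarrow>
      (\<Sum>\<^sub>\<infinity>j\<in>J. ennreal (norm (dual_pairing h (g j)) powr r)) \<le> ennreal (B * Lp_norm q h powr r)"
    using Bessel unfolding Bessel_sequence_def by blast
  obtain c \<delta> M and h :: "real ^ 'd \<Rightarrow> real ^ 'd \<Rightarrow> complex" where "c > 0" "\<delta> > 0"
    and h: "\<And>x. h x \<in> Lp q" "\<And>x. Lp_norm q (h x) = M"
    and below: "\<And>x \<gamma>. \<gamma> \<in> cube \<delta> x \<Longrightarrow> c \<le> norm (dual_pairing (h x) (translate \<gamma> f))"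
    using exists_uniform_test_functions[OF f] by metis
  define L where "L = nat \<lfloor>B * M powr r / c powr r\<rfloor>"
  have "emeasure (count_space J0) {j \<in> J0. \<Gamma> j \<in> cube \<delta> x} \<le> of_nat L" for x
  proof -
    let ?S = "{j \<in> J0. \<Gamma> j \<in> cube \<delta> x}"
    have "card G \<le> L" if G: "G \<subseteq> ?S" "finite G" for G
    proof -
      have "ennreal (real (card G) * c powr r) = (\<Sum>j\<in>G. ennreal (c powr r))"
        by (simp add: ennreal_mult ennreal_of_nat_eq_real_of_nat)
      also have "\<dots> \<le> (\<Sum>j\<in>G. ennreal (norm (dual_pairing (h x) (g j)) powr r))"
        using G J0 below \<open>c > 0\<close> r by (intro sum_mono ennreal_leI powr_mono2) auto
      also have "\<dots> \<le> (\<Sum>\<^sub>\<infinity>j\<in>J. ennreal (norm (dual_pairing (h x) (g j)) powr r))"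
        using G J0 by (subst nonneg_infsum_complete) (auto intro!: SUP_upper)
      also have "\<dots> \<le> ennreal (B * M powr r)"
        using B[OF h(1), of x] by (simp add: h(2))
      finally have "real (card G) * c powr r \<le> B * M powr r"
        using \<open>B > 0\<close> by (simp add: ennreal_le_iff)
      then have "real (card G) \<le> B * M powr r / c powr r"
        using \<open>c > 0\<close> by (simp add: field_simps)
      then show "card G \<le> L" unfolding L_def by (simp add: le_nat_floor)
    qed
    then have "finite ?S" "card ?S \<le> L"
      using finite_if_finite_subsets_card_bdd[of ?S L] by auto
    then show ?thesis by (simp add: emeasure_count_space)
  qed
  then have "upper_count J0 \<Gamma> \<delta> \<le> of_nat L"
    unfolding upper_count_def by (intro SUP_least)
  also have "\<dots> < \<infinity>" by (simp add: ennreal_of_nat_eq_real_of_nat)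
  finally show ?thesis
    by (rule upper_count_finite_rescale[OF \<open>\<delta> > 0\<close>])
qed

section \<open>Density of Bessel sequences and \<open>(C\<^sub>q)\<close>-systems of translates\<close>

theorem theorem3p5:
  fixes p q :: real and n :: nat
    and f :: "nat \<Rightarrow> real ^ 'd \<Rightarrow> complex"
    and I :: "nat \<Rightarrow> 'i set"
    and \<gamma> :: "nat \<Rightarrow> 'i \<Rightarrow> real ^ 'd"
  defines "J \<equiv> (SIGMA k:{1..n}. I k)"
    and "\<Gamma> \<equiv> (\<lambda>(k, i). \<gamma> k i)"
    and "g \<equiv> (\<lambda>(k, i). translate (\<gamma> k i) (f k))"
  assumes "1 < p" and "1 < q" and "1 / p + 1 / q = 1" and "1 \<le> n"
    and "\<And>k. k \<in> {1..n} \<Longrightarrow> f k \<in> Lp p"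
    and "\<And>k. k \<in> {1..n} \<Longrightarrow> \<not> (AE x in lebesgue. f k x = 0)"
    and "\<And>k. k \<in> {1..n} \<Longrightarrow> countable (I k)"
  shows "(\<forall>p'>1. Bessel_sequence p q p' J g \<longrightarrow> upper_Beurling_density J \<Gamma> < \<infinity>) \<and>
    (C_system p q J g \<longrightarrow> upper_Beurling_density J \<Gamma> = \<infinity>) \<and>
    (\<forall>p'>1. \<not> (Bessel_sequence p q p' J g \<and> C_system p q J g))"
proof -
  have Bessel: "upper_Beurling_density J \<Gamma> < \<infinity>" if "p' > 1" "Bessel_sequence p q p' J g" for p'
  proof -
    define Jk where "Jk k = {k} \<times> I k" for k
    have J: "J = (\<Union>k\<in>{1..n}. Jk k)" by (auto simp: J_def Jk_def)
    have "upper_count (Jk k) \<Gamma> 1 < \<infinity>" if "k \<in> {1..n}" for k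
    proof (rule Bessel_sequence_imp_upper_count_finite)
      show "Bessel_sequence p q p' J g" "p' > 0" "p \<ge> 1" "q > 0"
        using \<open>p' > 1\<close> \<open>Bessel_sequence p q p' J g\<close> assms by auto
      show "f k \<in> Lp p" "\<not> (AE x in lebesgue. f k x = 0)"
        using that assms by auto
      show "Jk k \<subseteq> J"
        using that J by blast
      show "g j = translate (\<Gamma> j) (f k)" if "j \<in> Jk k" for j
        using that by (auto simp: g_def \<Gamma>_def Jk_def)
    qed
    then have "(\<Sum>k\<in>{1..n}. upper_count (Jk k) \<Gamma> 1) < \<infinity>"
      by (simp add: less_top)
    then have "upper_count J \<Gamma> 1 < \<infinity>"
      unfolding J using upper_count_subadditive[of "{1..n}" Jk \<Gamma> 1] by (auto intro: le_less_trans)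
    then show ?thesis by (simp only: upper_Beurling_density_finite_iff)
  qed
  have C: "upper_Beurling_density J \<Gamma> = \<infinity>" if "C_system p q J g"
  proof -
    define F where "F x = (\<Sum>k\<in>{1..n}. ennreal (norm (f k x) powr p))" for x
    have [measurable]: "f k \<in> borel_measurable lebesgue" if "k \<in> {1..n}" for k
      using assms that by (simp add: Lp_def)
    have "upper_count J \<Gamma> 1 = \<infinity>"
    proof (rule C_system_imp_upper_count_infinite[where F = F])
      show "C_system p q J g" "p > 1" "q > 1" "1 / p + 1 / q = 1" by fact+
      show "F \<in> borel_measurable lebesgue" unfolding F_def by measurable
      have "(\<integral>\<^sup>+x. ennreal (norm (f k x) powr p) \<partial>lebesgue) < \<infinity>" if "k \<in> {1..n}" for k
        using assms that by (subst nn_integral_eq_integral) (auto simp: Lp_def)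
      then show "(\<integral>\<^sup>+x. F x \<partial>lebesgue) < \<infinity>"
        unfolding F_def by (subst nn_integral_sum) (auto simp: less_top)
      show "ennreal (norm (g j x) powr p) \<le> F (x - \<Gamma> j)" if "j \<in> J" for j x
      proof -
        obtain k i where j: "j = (k, i)" "k \<in> {1..n}" using \<open>j \<in> J\<close> by (auto simp: J_def)
        then have "ennreal (norm (f k (x - \<gamma> k i)) powr p) \<le> F (x - \<gamma> k i)"
          unfolding F_def by (intro member_le_sum) auto
        then show ?thesis
          by (simp add: j g_def \<Gamma>_def translate_def)
      qed
    qed
    then show ?thesis
      using upper_Beurling_density_finite_iff[of J \<Gamma>] by (simp add: not_less top_unique)
  qed
  show ?thesis
    using Bessel C by (metis less_irrefl)
qed

end
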